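(* Let $\Gamma:I\to\mathbb L^3$ be a regular curve such that $\Gamma'(s_0)$ $(s_0\in I)$ is a light-like vector, let $f$ be a generalized cuspidal edge along $\Gamma$ in $\mathbb L^3$, and put $p:=(s_0,0)$. Then the following two assertions are equivalent: (1) the normal direction of $f$ at $p$ is space-like (resp. light-like); (2) the order $i_p$ is equal to $2$ (resp. greater than or equal to $4$). In particular, $i_p>2$ implies $i_p\ge4$. Moreover, if $\Gamma$ is of type $L$ (i.e. $\Gamma'(s)$ is light-like for all $s\in I$) and $\Gamma''(s_0)\ne 0$, then (1) and (2) hold if and only if $\sigma^C(p)\ne0$ (resp. $\sigma^C(p)=0$).
   Context: $\mathbb L^3$ is $\mathbb R^3$ with $\langle a,b\rangle_L=a_1b_1+a_2b_2-a_3b_3$; a vector $a\ne0$ is space-like, time-like, light-like if $\langle a,a\rangle_L>0$, $<0$, $=0$. A generalized cuspidal edge along $\Gamma$ is a $C^\infty$-map $f:I\times(-\delta,\delta)\to\mathbb R^3$ ($I$ an open interval, $\delta>0$) with $\Gamma(s)=f(s,0)$ a regular curve, $f_t(s,0)=0$, and $f_{tt}(s,0),\Gamma'(s)$ linearly independent for all $s\in I$. The normal direction of $f$ at $(s,0)$ is the direction $\langle,\rangle_L$-orthogonal to $\Gamma'(s)$ and $f_{tt}(s,0)$. $\Delta_L=\langle f_s,f_s\rangle_L\langle f_t,f_t\rangle_L-\langle f_s,f_t\rangle_L^2$. The order $i_p$ of $p=(s,0)$ is the smallest $k$ with $\partial^k\Delta_L/\partial t^k(s,0)\neq0$ ($i_p=\infty$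 if there is none). $\sigma^C(p)=\operatorname{sgn}\det(\Gamma'(s),f_{tt}(s,0),\Gamma''(s))\in\{-1,0,1\}$ for $p=(s,0)$. "(resp. ...)" means that the statement holds both with the first alternatives throughout and with the second alternatives throughout.
   Formalization: In the "Moreover" part, the equivalences with σ^C are proved when Γ''(s_0) is not a multiple of Γ'(s_0); with only Γ''(s_0)≠0 they fail, e.g. Γ=(s+s²/2)(1,0,1), f=Γ+(t²/2)(0,0,1), s_0=0, and just σ^C≠0 ⇒ first alternative and second alternative ⇒ σ^C=0 are stated. *)

theory Defs
  imports "HOL-Analysis.Analysis" "HOL-Library.Extended_Nat"
begin

definition lorentz :: "real^3 \<Rightarrow> real^3 \<Rightarrow> real" where
  "lorentz a b = a$1 * b$1 + a$2 * b$2 - a$3 * b$3"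

definition space_like :: "real^3 \<Rightarrow> bool" where
  "space_like a \<longleftrightarrow> a \<noteq> 0 \<and> lorentz a a > 0"

definition light_like :: "real^3 \<Rightarrow> bool" where
  "light_like a \<longleftrightarrow> a \<noteq> 0 \<and> lorentz a a = 0"

text \<open>On an open set, a map is of class C^(k+1) iff it is differentiable and each of its
  directional derivatives is of class C^k.\<close>

primrec Ck_on :: "nat \<Rightarrow> 'a set \<Rightarrow> ('a::euclidean_space \<Rightarrow> 'b::real_normed_vector) \<Rightarrow> bool" where
  "Ck_on 0 U f \<longleftrightarrow> continuous_on U f"
| "Ck_on (Suc k) U f \<longleftrightarrow>
     (\<forall>x\<in>U. f differentiable (at x)) \<and> (\<forall>v. Ck_on k U (\<lambda>x. frechet_derivative f (at x) v))"

definition smooth_on :: "'a set \<Rightarrow> ('a::euclidean_space \<Rightarrow> 'b::real_normed_vector) \<Rightarrow> bool" where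
  "smooth_on U f \<longleftrightarrow> open U \<and> (\<forall>k. Ck_on k U f)"

definition open_interval :: "real set \<Rightarrow> bool" where
  "open_interval I \<longleftrightarrow> open I \<and> is_interval I \<and> I \<noteq> {}"

definition velocity :: "(real \<Rightarrow> real^3) \<Rightarrow> real \<Rightarrow> real^3" where
  "velocity \<Gamma> s = vector_derivative \<Gamma> (at s)"

definition acceleration :: "(real \<Rightarrow> real^3) \<Rightarrow> real \<Rightarrow> real^3" where
  "acceleration \<Gamma> s = vector_derivative (velocity \<Gamma>) (at s)"

definition regular_curve :: "real set \<Rightarrow> (real \<Rightarrow> real^3) \<Rightarrow> bool" where
  "regular_curve I \<Gamma> \<longleftrightarrow> smooth_on I \<Gamma> \<and> (\<forall>s\<in>I. velocity \<Gamma> s \<noteq> 0)"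

definition type_L :: "real set \<Rightarrow> (real \<Rightarrow> real^3) \<Rightarrow> bool" where
  "type_L I \<Gamma> \<longleftrightarrow> (\<forall>s\<in>I. light_like (velocity \<Gamma> s))"

definition partial_s :: "(real \<times> real \<Rightarrow> real^3) \<Rightarrow> real \<times> real \<Rightarrow> real^3" where
  "partial_s f = (\<lambda>(s, t). vector_derivative (\<lambda>x. f (x, t)) (at s))"

definition partial_t :: "(real \<times> real \<Rightarrow> real^3) \<Rightarrow> real \<times> real \<Rightarrow> real^3" where
  "partial_t f = (\<lambda>(s, t). vector_derivative (\<lambda>y. f (s, y)) (at t))"

abbreviation partial_tt :: "(real \<times> real \<Rightarrow> real^3) \<Rightarrow> real \<times> real \<Rightarrow> real^3" where
  "partial_tt f \<equiv> partial_t (partial_t f)"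

text \<open>Linear independence of the pair of vectors requires that the two are distinct,
  since \<^term>\<open>independent\<close> only sees the set of the two.\<close>

definition generalized_cuspidal_edge ::
    "real set \<Rightarrow> real \<Rightarrow> (real \<Rightarrow> real^3) \<Rightarrow> (real \<times> real \<Rightarrow> real^3) \<Rightarrow> bool" where
  "generalized_cuspidal_edge I \<delta> \<Gamma> f \<longleftrightarrow>
     open_interval I \<and> \<delta> > 0 \<and>
     smooth_on (I \<times> {-\<delta><..<\<delta>}) f \<and>
     regular_curve I \<Gamma> \<and>
     (\<forall>s\<in>I. f (s, 0) = \<Gamma> s \<and>
            partial_t f (s, 0) = 0 \<and>
            partial_tt f (s, 0) \<noteq> velocity \<Gamma> s \<and>
            independent {partial_tt f (s, 0), velocity \<Gamma> s})"

definition normal_direction ::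
    "(real \<Rightarrow> real^3) \<Rightarrow> (real \<times> real \<Rightarrow> real^3) \<Rightarrow> real \<Rightarrow> (real^3) set" where
  "normal_direction \<Gamma> f s =
     {v. lorentz v (velocity \<Gamma> s) = 0 \<and> lorentz v (partial_tt f (s, 0)) = 0}"

definition space_like_direction :: "(real^3) set \<Rightarrow> bool" where
  "space_like_direction D \<longleftrightarrow> (\<exists>v. space_like v \<and> D = span {v})"

definition light_like_direction :: "(real^3) set \<Rightarrow> bool" where
  "light_like_direction D \<longleftrightarrow> (\<exists>v. light_like v \<and> D = span {v})"

definition Delta_L :: "(real \<times> real \<Rightarrow> real^3) \<Rightarrow> real \<times> real \<Rightarrow> real" where
  "Delta_L f p =
     lorentz (partial_s f p) (partial_s f p) * lorentz (partial_t f p) (partial_t f p)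
     - (lorentz (partial_s f p) (partial_t f p))\<^sup>2"

definition Delta_order :: "(real \<times> real \<Rightarrow> real^3) \<Rightarrow> real \<Rightarrow> enat" where
  "Delta_order f s =
     (let D = (\<lambda>k. (deriv ^^ k) (\<lambda>t. Delta_L f (s, t)) 0)
      in if \<exists>k. D k \<noteq> 0 then enat (LEAST k. D k \<noteq> 0) else \<infinity>)"

definition sigma_C :: "(real \<Rightarrow> real^3) \<Rightarrow> (real \<times> real \<Rightarrow> real^3) \<Rightarrow> real \<Rightarrow> real" where
  "sigma_C \<Gamma> f s =
     sgn (det (vector [velocity \<Gamma> s, partial_tt f (s, 0), acceleration \<Gamma> s] :: real^3^3))"

text \<open>Nonvanishing of the acceleration in every regular parametrization: under
  \<open>s = \<phi> u\<close> the acceleration becomes \<open>(\<phi>' u)\<^sup>2 *\<^sub>R acceleration \<Gamma> s + \<phi>'' u *\<^sub>R velocity \<Gamma> s\<close>,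
  and \<open>\<phi>'' u\<close> is arbitrary. Plain \<open>acceleration \<Gamma> s \<noteq> 0\<close> is weaker: it also holds for the
  reparametrized null line \<open>(s + s\<^sup>2/2) *\<^sub>R (1, 0, 1)\<close>, along which \<open>sigma_C\<close> vanishes for every \<open>f\<close>.\<close>

definition nonzero_curvature_at :: "(real \<Rightarrow> real^3) \<Rightarrow> real \<Rightarrow> bool" where
  "nonzero_curvature_at \<Gamma> s \<longleftrightarrow> acceleration \<Gamma> s \<notin> span {velocity \<Gamma> s}"

end

theory Submission
  imports Defs
begin

text \<open>
  Everything in the theorem is governed by one number: with \<open>\<xi> = \<Gamma>' s\<^sub>0\<close> and \<open>w = f\<^sub>t\<^sub>t (s\<^sub>0, 0)\<close>, it is
  \<open>c = \<langle>\<xi>, w\<rangle>\<^sub>L\<close>. The space-like alternative, the order 2 and (for a curve of type L whose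
  acceleration is independent of its velocity) \<open>\<sigma>\<^sup>C \<noteq> 0\<close> each say \<open>c \<noteq> 0\<close>; the other alternatives each say \<open>c = 0\<close>.

  Normal direction: it is spanned by the Lorentzian cross product \<open>n\<close> of \<open>\<xi>\<close> and \<open>w\<close>, and Lagrange's
  identity gives \<open>\<langle>n, n\<rangle>\<^sub>L = c\<^sup>2 - \<langle>\<xi>, \<xi>\<rangle>\<^sub>L \<langle>w, w\<rangle>\<^sub>L = c\<^sup>2\<close>, because \<open>\<xi>\<close> is light-like
  (\<open>normal_direction_eq_span\<close>, \<open>lorentz_normal_vector\<close>).

  Order: along \<open>t \<mapsto> (s\<^sub>0, t)\<close> the field \<open>f\<^sub>t\<close> vanishes at \<open>t = 0\<close>, so
  \<open>\<langle>f\<^sub>t, f\<^sub>t\<rangle>\<^sub>L = O(t\<^sup>2)\<close> and \<open>\<langle>f\<^sub>s, f\<^sub>t\<rangle>\<^sub>L = c t + O(t\<^sup>2)\<close>. Since \<open>f\<^sub>t (s, 0) = 0\<close> for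
  all \<open>s\<close>, the symmetry of mixed partial derivatives gives \<open>f\<^sub>s\<^sub>t (s\<^sub>0, 0) = 0\<close>
  (\<open>mixed_partial_eq_0\<close>); with \<open>\<langle>\<xi>, \<xi>\<rangle>\<^sub>L = 0\<close> this yields \<open>\<langle>f\<^sub>s, f\<^sub>s\<rangle>\<^sub>L = O(t\<^sup>2)\<close>. Hence
  \<open>\<Delta>\<^sub>L = O(t\<^sup>4) - (c t + O(t\<^sup>2))\<^sup>2\<close>: the order is 2 if \<open>c \<noteq> 0\<close>, and if \<open>c = 0\<close> the cubic term
  vanishes together with the quadratic one, so that the order jumps to at least 4
  (\<open>gram_tower_at_singular_point\<close>).

  Type L: differentiating \<open>\<langle>\<Gamma>', \<Gamma>'\<rangle>\<^sub>L = 0\<close> shows \<open>\<langle>\<xi>, \<Gamma>''\<rangle>\<^sub>L = 0\<close>. The Lorentz-orthogonal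
  complement of a light-like \<open>\<xi>\<close> is a plane that contains \<open>\<xi>\<close> itself, so it is the plane of \<open>\<xi>\<close> and
  \<open>\<Gamma>''\<close> as soon as these are independent; therefore \<open>det (\<xi>, w, \<Gamma>'')\<close> is a multiple of \<open>\<langle>\<xi>, w\<rangle>\<^sub>L\<close>,
  with a nonzero factor when \<open>\<xi>\<close> and \<open>\<Gamma>''\<close> are independent (\<open>det_null_tangent\<close>).
\<close>

section \<open>Directional derivatives of smooth maps\<close>

text \<open>The second difference of \<open>f\<close> over the parallelogram spanned by \<open>h u\<close> and \<open>h v\<close> is, by the mean value
  theorem in the direction \<open>u\<close>, \<open>h\<close> times an increment of the derivative along \<open>u\<close>; differentiability of
  that derivative at the single point \<open>x\<close> controls the increment.\<close>

lemma second_difference_quotient: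
  fixes f :: "'a::real_normed_vector \<Rightarrow> real"
  assumes U: "open U" "x \<in> U"
    and f: "\<And>y. y \<in> U \<Longrightarrow> f differentiable (at y)"
    and Du: "((\<lambda>y. frechet_derivative f (at y) u) has_derivative Du) (at x)"
  shows "((\<lambda>h. (f (x + h *\<^sub>R u + h *\<^sub>R v) - f (x + h *\<^sub>R u) - f (x + h *\<^sub>R v) + f x) / h\<^sup>2)
           \<longlongrightarrow> Du v) (at_right 0)"
proof -
  define g where "g = (\<lambda>y. frechet_derivative f (at y) u)"
  define q where "q = (\<lambda>h. (f (x + h *\<^sub>R u + h *\<^sub>R v) - f (x + h *\<^sub>R u)
                              - f (x + h *\<^sub>R v) + f x) / h\<^sup>2)"
  define M where "M = 2 * norm u + norm v + 1"
  have "M > 0" by (simp add: M_def add_nonneg_pos)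
  interpret Du: bounded_linear Du by (rule has_derivative_bounded_linear[OF Du])
  have "(q \<longlongrightarrow> Du v) (at_right 0)"
  proof (rule tendstoI)
    fix e :: real assume "e > 0"
    \<comment> \<open>All increments from \<open>x\<close> below are at most \<open>h M\<close>, and those of \<open>g\<close> enter with total weight below \<open>M\<close>;
      the factor 2 leaves room for a strict inequality.\<close>
    define e' where "e' = e / (2 * M)"
    have "e' > 0" using \<open>e > 0\<close> \<open>M > 0\<close> by (simp add: e'_def)
    from U obtain r where r: "r > 0" "ball x r \<subseteq> U"
      by (meson open_contains_ball)
    from Du \<open>e' > 0\<close> obtain d where d: "d > 0"
      "\<And>y. norm (y - x) < d \<Longrightarrow> norm (g y - g x - Du (y - x)) \<le> e' * norm (y - x)"
      unfolding has_derivative_at_alt g_def by metis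
    define m where "m = min r d / M"
    have "m > 0" using r(1) d(1) \<open>M > 0\<close> by (simp add: m_def)
    have "dist (q h) (Du v) < e" if h: "0 < h" "h < m" for h
    proof -
      have small: "norm (\<theta> *\<^sub>R u + \<eta> *\<^sub>R v) < min r d"
        if "0 \<le> \<theta>" "\<theta> \<le> h" "0 \<le> \<eta>" "\<eta> \<le> h" for \<theta> \<eta>
      proof -
        have "norm (\<theta> *\<^sub>R u + \<eta> *\<^sub>R v) \<le> \<theta> * norm u + \<eta> * norm v"
          using norm_triangle_ineq[of "\<theta> *\<^sub>R u" "\<eta> *\<^sub>R v"] that by simp
        also have "\<dots> \<le> h * norm u + h * norm v"
          using that by (intro add_mono mult_right_mono) auto
        also have "\<dots> \<le> h * M" using h by (simp add: M_def algebra_simps)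
        also have "\<dots> < min r d" using h(2) \<open>M > 0\<close> by (simp add: m_def pos_less_divide_eq)
        finally show ?thesis .
      qed
      have in_U: "x + \<theta> *\<^sub>R u + \<eta> *\<^sub>R v \<in> U"
        if "0 \<le> \<theta>" "\<theta> \<le> h" "0 \<le> \<eta>" "\<eta> \<le> h" for \<theta> \<eta>
        using small[OF that] r(2) by (auto simp: dist_norm norm_minus_commute add.assoc subset_iff)
      have line: "((\<lambda>\<theta>. f (x + \<theta> *\<^sub>R u + \<eta> *\<^sub>R v)) has_real_derivative
                    g (x + \<theta> *\<^sub>R u + \<eta> *\<^sub>R v)) (at \<theta>)"
        if "0 \<le> \<theta>" "\<theta> \<le> h" "0 \<le> \<eta>" "\<eta> \<le> h" for \<theta> \<eta>
      proof -
        have "(f has_derivative frechet_derivative f (at (x + \<theta> *\<^sub>R u + \<eta> *\<^sub>R v)))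
                (at (x + \<theta> *\<^sub>R u + \<eta> *\<^sub>R v))"
          using f[OF in_U[OF that]] frechet_derivative_works by blast
        moreover have "((\<lambda>\<theta>. x + \<theta> *\<^sub>R u + \<eta> *\<^sub>R v) has_vector_derivative u) (at \<theta>)"
          by (auto intro!: derivative_eq_intros)
        ultimately have "((f \<circ> (\<lambda>\<theta>. x + \<theta> *\<^sub>R u + \<eta> *\<^sub>R v)) has_vector_derivative
            g (x + \<theta> *\<^sub>R u + \<eta> *\<^sub>R v)) (at \<theta>)"
          unfolding g_def
          by (intro vector_derivative_diff_chain_within) (auto intro: has_derivative_at_withinI)
        then show ?thesis
          by (simp add: has_real_derivative_iff_has_vector_derivative o_def)
      qed
      \<comment> \<open>The second difference is the increment over \<open>[0, h]\<close> of
        \<open>\<theta> \<mapsto> f (x + \<theta> u + h v) - f (x + \<theta> u)\<close>; the zero multiples let both terms fit \<open>line\<close>.\<close>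
      have "\<exists>\<theta>. 0 < \<theta> \<and> \<theta> < h \<and>
          (f (x + h *\<^sub>R u + h *\<^sub>R v) - f (x + h *\<^sub>R u + 0 *\<^sub>R v))
          - (f (x + 0 *\<^sub>R u + h *\<^sub>R v) - f (x + 0 *\<^sub>R u + 0 *\<^sub>R v))
          = (h - 0) * (g (x + \<theta> *\<^sub>R u + h *\<^sub>R v) - g (x + \<theta> *\<^sub>R u + 0 *\<^sub>R v))"
        using h by (intro MVT2 DERIV_diff line) auto
      then obtain \<theta> where \<theta>: "0 < \<theta>" "\<theta> < h"
        and eq: "f (x + h *\<^sub>R u + h *\<^sub>R v) - f (x + h *\<^sub>R u) - f (x + h *\<^sub>R v) + f x
          = h * (g (x + \<theta> *\<^sub>R u + h *\<^sub>R v) - g (x + \<theta> *\<^sub>R u))"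
        by (auto simp: algebra_simps)
      define P where "P = g (x + \<theta> *\<^sub>R u + h *\<^sub>R v) - g x - Du (\<theta> *\<^sub>R u + h *\<^sub>R v)"
      define Q where "Q = g (x + \<theta> *\<^sub>R u) - g x - Du (\<theta> *\<^sub>R u)"
      have "\<bar>P\<bar> \<le> e' * norm (\<theta> *\<^sub>R u + h *\<^sub>R v)"
        using d(2)[of "x + \<theta> *\<^sub>R u + h *\<^sub>R v"] small[of \<theta> h] \<theta> h by (simp add: P_def add.assoc)
      also have "\<dots> \<le> e' * (h * norm u + h * norm v)"
      proof (intro mult_left_mono)
        have "norm (\<theta> *\<^sub>R u + h *\<^sub>R v) \<le> \<theta> * norm u + h * norm v"
          using norm_triangle_ineq[of "\<theta> *\<^sub>R u" "h *\<^sub>R v"] \<theta> h by simp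
        also have "\<dots> \<le> h * norm u + h * norm v" using \<theta> by (intro add_mono mult_right_mono) auto
        finally show "norm (\<theta> *\<^sub>R u + h *\<^sub>R v) \<le> h * norm u + h * norm v" .
      qed (use \<open>e' > 0\<close> in simp)
      finally have P: "\<bar>P\<bar> \<le> e' * (h * norm u + h * norm v)" .
      have "\<bar>Q\<bar> \<le> e' * (\<theta> * norm u)"
        using d(2)[of "x + \<theta> *\<^sub>R u"] small[of \<theta> 0] \<theta> h by (simp add: Q_def)
      also have "\<dots> \<le> e' * (h * norm u)"
        using \<theta> \<open>e' > 0\<close> by (intro mult_left_mono mult_right_mono) auto
      finally have Q: "\<bar>Q\<bar> \<le> e' * (h * norm u)" .
      have "q h - Du v = (P - Q) / h"
        using h(1) unfolding q_def eq P_def Q_def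
        by (simp add: Du.add Du.scaleR field_simps power2_eq_square)
      also have "\<bar>\<dots>\<bar> \<le> (\<bar>P\<bar> + \<bar>Q\<bar>) / h"
        using h(1) by (simp add: divide_right_mono)
      also have "\<dots> \<le> (e' * (h * norm u + h * norm v) + e' * (h * norm u)) / h"
        using P Q h(1) by (intro divide_right_mono add_mono) auto
      also have "\<dots> = e' * (2 * norm u + norm v)" using h(1) by (simp add: field_simps)
      also have "\<dots> \<le> e' * M" using \<open>e' > 0\<close> by (simp add: M_def)
      also have "\<dots> < e" using \<open>e > 0\<close> \<open>M > 0\<close> by (simp add: e'_def)
      finally show ?thesis by (simp add: dist_real_def)
    qed
    then show "\<forall>\<^sub>F h in at_right 0. dist (q h) (Du v) < e"
      using \<open>m > 0\<close> by (auto simp: eventually_at_right)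
  qed
  then show ?thesis by (simp add: q_def)
qed

text \<open>The second difference is symmetric in \<open>u\<close> and \<open>v\<close>, hence so is its limit.\<close>

lemma symmetric_second_derivative_real:
  fixes f :: "'a::real_normed_vector \<Rightarrow> real"
  assumes U: "open U" "x \<in> U"
    and f: "\<And>y. y \<in> U \<Longrightarrow> f differentiable (at y)"
    and Du: "((\<lambda>y. frechet_derivative f (at y) u) has_derivative Du) (at x)"
    and Dv: "((\<lambda>y. frechet_derivative f (at y) v) has_derivative Dv) (at x)"
  shows "Du v = Dv u"
proof (rule tendsto_unique[OF _ second_difference_quotient[OF U f Du]])
  show "((\<lambda>h. (f (x + h *\<^sub>R u + h *\<^sub>R v) - f (x + h *\<^sub>R u) - f (x + h *\<^sub>R v) + f x) / h\<^sup>2)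
          \<longlongrightarrow> Dv u) (at_right 0)"
    using second_difference_quotient[OF U f Dv, of u] by (simp add: algebra_simps)
qed simp

text \<open>The mean value theorem fails for vector-valued maps, so each scalar component is treated by itself.\<close>

proposition symmetric_second_derivative:
  fixes f :: "'a::real_normed_vector \<Rightarrow> 'b::real_inner"
  assumes U: "open U" "x \<in> U"
    and f: "\<And>y. y \<in> U \<Longrightarrow> f differentiable (at y)"
    and Du: "((\<lambda>y. frechet_derivative f (at y) u) has_derivative Du) (at x)"
    and Dv: "((\<lambda>y. frechet_derivative f (at y) v) has_derivative Dv) (at x)"
  shows "Du v = Dv u"
proof -
  have "Du v \<bullet> b = Dv u \<bullet> b" for b
  proof (rule symmetric_second_derivative_real[OF U, where f = "\<lambda>y. f y \<bullet> b"])
    have fb: "((\<lambda>y. f y \<bullet> b) has_derivative (\<lambda>h. frechet_derivative f (at y) h \<bullet> b)) (at y)"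
      if "y \<in> U" for y
      using f[OF that] by (intro has_derivative_inner_left) (simp add: frechet_derivative_works)
    then show "(\<lambda>y. f y \<bullet> b) differentiable (at y)" if "y \<in> U" for y
      using that differentiable_def by blast
    have "((\<lambda>y. frechet_derivative (\<lambda>y. f y \<bullet> b) (at y) w) has_derivative (\<lambda>h. Dw h \<bullet> b)) (at x)"
      if "((\<lambda>y. frechet_derivative f (at y) w) has_derivative Dw) (at x)" for w Dw
    proof (rule has_derivative_transform_within_open[OF has_derivative_inner_left[OF that] U])
      show "frechet_derivative f (at y) w \<bullet> b = frechet_derivative (\<lambda>y. f y \<bullet> b) (at y) w"
        if "y \<in> U" for y
        using frechet_derivative_at[OF fb[OF that]] by metis
    qed
    from this[OF Du] this[OF Dv]
    show "((\<lambda>y. frechet_derivative (\<lambda>y. f y \<bullet> b) (at y) u) has_derivative (\<lambda>h. Du h \<bullet> b)) (at x)"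
      "((\<lambda>y. frechet_derivative (\<lambda>y. f y \<bullet> b) (at y) v) has_derivative (\<lambda>h. Dv h \<bullet> b)) (at x)" .
  qed
  then show ?thesis by (metis vector_eq_rdot)
qed

text \<open>The direction comes first, so that \<open>directional_deriv v\<close> is an operator on maps and can be iterated.\<close>

definition directional_deriv ::
    "'a::real_normed_vector \<Rightarrow> ('a \<Rightarrow> 'b::real_normed_vector) \<Rightarrow> 'a \<Rightarrow> 'b" where
  "directional_deriv v f x = frechet_derivative f (at x) v"

lemma smooth_on_imp_has_derivative:
  assumes "smooth_on U f" "x \<in> U"
  shows "(f has_derivative (\<lambda>v. directional_deriv v f x)) (at x)"
proof -
  have "Ck_on (Suc 0) U f" using assms(1) unfolding smooth_on_def by blast
  then have "f differentiable (at x)" using assms(2) by simp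
  then show ?thesis by (simp add: frechet_derivative_works directional_deriv_def)
qed

lemma smooth_on_directional_deriv:
  assumes "smooth_on U f"
  shows "smooth_on U (directional_deriv v f)"
proof -
  have "Ck_on k U (directional_deriv v f)" for k
  proof -
    have "Ck_on (Suc k) U f" using assms unfolding smooth_on_def by blast
    then have "Ck_on k U (\<lambda>x. frechet_derivative f (at x) v)" by simp
    then show ?thesis by (simp add: directional_deriv_def [abs_def])
  qed
  then show ?thesis using assms by (simp add: smooth_on_def)
qed

lemma directional_deriv_commute:
  fixes f :: "'a::euclidean_space \<Rightarrow> 'b::real_inner"
  assumes f: "smooth_on U f" and x: "x \<in> U"
  shows "directional_deriv v (directional_deriv u f) x = directional_deriv u (directional_deriv v f) x"
proof -
  have U: "open U" using f by (simp add: smooth_on_def)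
  have diff: "f differentiable (at y)" if "y \<in> U" for y
    using smooth_on_imp_has_derivative[OF f that] differentiable_def by blast
  have "((\<lambda>y. frechet_derivative f (at y) w) has_derivative
          (\<lambda>z. directional_deriv z (directional_deriv w f) x)) (at x)" for w
    using smooth_on_imp_has_derivative[OF smooth_on_directional_deriv[OF f] x]
    by (simp add: directional_deriv_def [abs_def])
  from symmetric_second_derivative[OF U x diff this this] show ?thesis .
qed

lemma has_vector_derivative_along_line:
  assumes f: "smooth_on U f" and x: "p + t *\<^sub>R v \<in> U"
  shows "((\<lambda>t. f (p + t *\<^sub>R v)) has_vector_derivative directional_deriv v f (p + t *\<^sub>R v)) (at t)"
proof -
  have "((\<lambda>t. p + t *\<^sub>R v) has_vector_derivative v) (at t)"
    by (auto intro!: derivative_eq_intros)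
  then have "((f \<circ> (\<lambda>t. p + t *\<^sub>R v)) has_vector_derivative directional_deriv v f (p + t *\<^sub>R v)) (at t)"
    by (rule vector_derivative_diff_chain_within)
      (use smooth_on_imp_has_derivative[OF f x] in \<open>auto intro: has_derivative_at_withinI\<close>)
  then show ?thesis by (simp add: o_def)
qed

section \<open>Towers of derivatives\<close>

text \<open>A tower is a function \<open>g 0\<close> with all its derivatives \<open>g 1\<close>, \<open>g 2\<close>, and so on. Carrying them
  along explicitly makes higher derivatives of products computable by rewriting.\<close>

definition derivative_tower :: "real set \<Rightarrow> (nat \<Rightarrow> real \<Rightarrow> 'a::real_normed_vector) \<Rightarrow> bool" where
  "derivative_tower S g \<longleftrightarrow> (\<forall>k. \<forall>t\<in>S. (g k has_vector_derivative g (Suc k) t) (at t))"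

text \<open>The unsummed form of Leibniz' formula: no binomial coefficients are collected, and for a fixed order
  the simplifier expands it.\<close>

primrec product_tower ::
    "('a \<Rightarrow> 'b \<Rightarrow> 'c::plus) \<Rightarrow> (nat \<Rightarrow> real \<Rightarrow> 'a) \<Rightarrow> (nat \<Rightarrow> real \<Rightarrow> 'b) \<Rightarrow> nat \<Rightarrow> real \<Rightarrow> 'c" where
  "product_tower p a b 0 = (\<lambda>t. p (a 0 t) (b 0 t))"
| "product_tower p a b (Suc n) =
     (\<lambda>t. product_tower p a (\<lambda>k. b (Suc k)) n t + product_tower p (\<lambda>k. a (Suc k)) b n t)"

lemma derivative_tower_product:
  assumes p: "bounded_bilinear p" and "derivative_tower S a" "derivative_tower S b"
  shows "derivative_tower S (product_tower p a b)"
proof -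
  have "(product_tower p a b n has_vector_derivative product_tower p a b (Suc n) t) (at t)"
    if "derivative_tower S a" "derivative_tower S b" "t \<in> S" for n t a b
    using that
  proof (induction n arbitrary: a b)
    case 0
    then show ?case
      using bounded_bilinear.has_vector_derivative[OF p]
      by (simp add: derivative_tower_def)
  next
    case (Suc n)
    have "derivative_tower S (\<lambda>k. a (Suc k))" "derivative_tower S (\<lambda>k. b (Suc k))"
      using Suc.prems by (auto simp: derivative_tower_def)
    with Suc.IH Suc.prems show ?case
      by (simp only: product_tower.simps(2)) (intro has_vector_derivative_add; blast)
  qed
  with assms show ?thesis by (simp add: derivative_tower_def)
qed

lemma derivative_tower_diff:
  assumes "derivative_tower S a" "derivative_tower S b"
  shows "derivative_tower S (\<lambda>k t. a k t - b k t)"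
  using assms by (auto simp: derivative_tower_def intro!: derivative_intros)

lemma higher_deriv_eq_tower:
  fixes g :: "nat \<Rightarrow> real \<Rightarrow> real"
  assumes g: "derivative_tower S g" and S: "open S" "t \<in> S"
  shows "(deriv ^^ n) (g 0) t = g n t"
  using S(2)
proof (induction n arbitrary: t)
  case (Suc n)
  have "\<forall>\<^sub>F y in nhds t. (deriv ^^ n) (g 0) y = g n y"
    using eventually_nhds_in_open[OF S(1) Suc.prems] by eventually_elim (rule Suc.IH)
  then have "(deriv ^^ Suc n) (g 0) t = deriv (g n) t"
    by (auto intro: deriv_cong_ev)
  also have "\<dots> = g (Suc n) t"
    using g Suc.prems
    by (auto simp: derivative_tower_def has_real_derivative_iff_has_vector_derivative
        intro!: DERIV_imp_deriv)
  finally show ?case .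
qed simp

lemma derivative_tower_along_line:
  assumes "smooth_on U f"
  shows "derivative_tower {t. p + t *\<^sub>R v \<in> U} (\<lambda>k t. (directional_deriv v ^^ k) f (p + t *\<^sub>R v))"
proof -
  have "smooth_on U ((directional_deriv v ^^ k) f)" for k
    by (induction k) (simp_all add: assms smooth_on_directional_deriv)
  then show ?thesis
    by (auto simp: derivative_tower_def intro: has_vector_derivative_along_line)
qed

section \<open>The order of the Gram determinant along the singular curve\<close>

lemma bounded_bilinear_lorentz: "bounded_bilinear lorentz"
proof -
  have "bilinear lorentz"
    by (auto simp: bilinear_def lorentz_def algebra_simps intro!: linearI)
  then show ?thesis by (simp add: bilinear_conv_bounded_bilinear)
qed

lemma lorentz_commute: "lorentz a b = lorentz b a"
  by (simp add: lorentz_def mult.commute)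

lemma lorentz_zero [simp]: "lorentz 0 b = 0" "lorentz a 0 = 0"
  by (simp_all add: lorentz_def)

text \<open>Write \<open>D = u v - w\<^sup>2\<close> for the three Lorentz products. The hypotheses make \<open>u\<close> and \<open>v\<close> vanish to second
  order, so \<open>u v\<close> contributes nothing up to the third derivative, and \<open>w\<close> has a zero with
  derivative \<open>\<langle>a, b'\<rangle>\<^sub>L\<close>.\<close>

lemma gram_tower_at_singular_point:
  assumes a: "derivative_tower S a" and b: "derivative_tower S b"
    and S: "open S" "t \<in> S"
    and null: "lorentz (a 0 t) (a 0 t) = 0" and a1: "a 1 t = 0" and b0: "b 0 t = 0"
  defines "D \<equiv> (\<lambda>t. lorentz (a 0 t) (a 0 t) * lorentz (b 0 t) (b 0 t) - (lorentz (a 0 t) (b 0 t))\<^sup>2)"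
  shows "(deriv ^^ 0) D t = 0" "(deriv ^^ 1) D t = 0"
    "(deriv ^^ 2) D t = - 2 * (lorentz (a 0 t) (b 1 t))\<^sup>2"
    "lorentz (a 0 t) (b 1 t) = 0 \<Longrightarrow> (deriv ^^ 3) D t = 0"
proof -
  define u where "u = product_tower lorentz a a"
  define v where "v = product_tower lorentz b b"
  define w where "w = product_tower lorentz a b"
  define T where "T = (\<lambda>k t. product_tower (*) u v k t - product_tower (*) w w k t)"
  have "derivative_tower S T"
    unfolding T_def u_def v_def w_def using a b
    by (intro derivative_tower_diff derivative_tower_product bounded_bilinear_mult
        bounded_bilinear_lorentz)
  moreover have "D = T 0"
    by (simp add: D_def T_def u_def v_def w_def power2_eq_square)
  ultimately have D: "(deriv ^^ n) D t = T n t" for n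
    using higher_deriv_eq_tower S by blast
  have uvw: "u 0 t = 0" "u (Suc 0) t = 0" "v 0 t = 0" "v (Suc 0) t = 0" "w 0 t = 0"
    "w (Suc 0) t = lorentz (a 0 t) (b 1 t)"
    using null a1 b0 by (simp_all add: u_def v_def w_def)
  show "(deriv ^^ 0) D t = 0" "(deriv ^^ 1) D t = 0"
    "(deriv ^^ 2) D t = - 2 * (lorentz (a 0 t) (b 1 t))\<^sup>2"
    "lorentz (a 0 t) (b 1 t) = 0 \<Longrightarrow> (deriv ^^ 3) D t = 0"
    unfolding D T_def by (simp_all add: numeral_eq_Suc uvw)
qed

text \<open>Stated for a map \<open>g\<close> that agrees with \<open>f\<close> only on \<open>U\<close>, since the second partial derivative is taken of
  a first one that is known to be smooth only there.\<close>

lemma partials_eq_directional_deriv: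
  assumes f: "smooth_on U f" and eq: "\<And>y. y \<in> U \<Longrightarrow> g y = f y" and x: "(s, t) \<in> U"
  shows "partial_s g (s, t) = directional_deriv (1, 0) f (s, t)"
    and "partial_t g (s, t) = directional_deriv (0, 1) f (s, t)"
proof -
  have U: "open U" using f by (simp add: smooth_on_def)
  have slices: "open ((\<lambda>y. (y, t)) -` U)" "open ((\<lambda>y. (s, y)) -` U)"
    by (intro open_vimage U continuous_intros)+
  have "((\<lambda>y. f (y, t)) has_vector_derivative directional_deriv (1, 0) f (s, t)) (at s)"
    using has_vector_derivative_along_line[OF f, of "(0, t)" s "(1, 0)"] x by simp
  then have "((\<lambda>y. g (y, t)) has_vector_derivative directional_deriv (1, 0) f (s, t)) (at s)"
    by (rule has_vector_derivative_transform_within_open[OF _ slices(1)]) (use x eq in auto)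
  moreover have "((\<lambda>y. f (s, y)) has_vector_derivative directional_deriv (0, 1) f (s, t)) (at t)"
    using has_vector_derivative_along_line[OF f, of "(s, 0)" t "(0, 1)"] x by simp
  then have "((\<lambda>y. g (s, y)) has_vector_derivative directional_deriv (0, 1) f (s, t)) (at t)"
    by (rule has_vector_derivative_transform_within_open[OF _ slices(2)]) (use x eq in auto)
  ultimately show "partial_s g (s, t) = directional_deriv (1, 0) f (s, t)"
    "partial_t g (s, t) = directional_deriv (0, 1) f (s, t)"
    by (simp_all add: partial_s_def partial_t_def vector_derivative_at)
qed

text \<open>Interchange the derivatives: \<open>f\<^sub>t\<close> vanishes along the whole singular curve.\<close>

lemma mixed_partial_eq_0:
  assumes edge: "generalized_cuspidal_edge I \<delta> \<Gamma> f" and s: "s \<in> I"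
  shows "directional_deriv (0, 1) (directional_deriv (1, 0) f) (s, 0) = 0"
proof -
  define U where "U = I \<times> {-\<delta><..<\<delta>}"
  define B where "B = directional_deriv (0, 1) f"
  have f: "smooth_on U f" and \<delta>: "\<delta> > 0" and I: "open I"
    using edge by (auto simp: generalized_cuspidal_edge_def open_interval_def U_def)
  have B0: "B (y, 0) = 0" if "y \<in> I" for y
    using edge that \<delta> partials_eq_directional_deriv(2)[OF f, of f y 0]
    by (simp add: generalized_cuspidal_edge_def U_def B_def)
  have sU: "(s, 0) \<in> U" using s \<delta> by (simp add: U_def)
  have B: "smooth_on U B" unfolding B_def by (rule smooth_on_directional_deriv[OF f])
  have "((\<lambda>y. B (y, 0)) has_vector_derivative directional_deriv (1, 0) B (s, 0)) (at s)"
    using has_vector_derivative_along_line[OF B, of "(0, 0)" s "(1, 0)"] sU by simp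
  moreover have "((\<lambda>y. B (y, 0)) has_vector_derivative 0) (at s)"
    by (rule has_vector_derivative_transform_within_open[OF has_vector_derivative_const I s])
      (simp add: B0)
  ultimately have "directional_deriv (1, 0) B (s, 0) = 0"
    by (rule vector_derivative_unique_at)
  then show ?thesis using directional_deriv_commute[OF f sU] by (simp add: B_def)
qed

text \<open>The Gram lemma is applied to \<open>f\<^sub>s\<close> and \<open>f\<^sub>t\<close> along \<open>t \<mapsto> (s, t)\<close>. The partial derivatives agree with smooth
  directional derivatives only near \<open>t = 0\<close>, which is all that derivatives at \<open>0\<close> can see.\<close>

lemma Delta_L_derivatives_at_null_tangent:
  assumes edge: "generalized_cuspidal_edge I \<delta> \<Gamma> f" and s: "s \<in> I"
    and null: "lorentz (velocity \<Gamma> s) (velocity \<Gamma> s) = 0"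
  defines "c \<equiv> lorentz (velocity \<Gamma> s) (partial_tt f (s, 0))"
    and "D \<equiv> \<lambda>k. (deriv ^^ k) (\<lambda>t. Delta_L f (s, t)) 0"
  shows "D 0 = 0" "D 1 = 0" "D 2 = - 2 * c\<^sup>2" "c = 0 \<Longrightarrow> D 3 = 0"
proof -
  define U where "U = I \<times> {-\<delta><..<\<delta>}"
  have f: "smooth_on U f" and \<delta>: "\<delta> > 0" and I: "open I"
    and \<Gamma>: "\<And>y. y \<in> I \<Longrightarrow> f (y, 0) = \<Gamma> y" and ft0: "partial_t f (s, 0) = 0"
    using edge s by (auto simp: generalized_cuspidal_edge_def open_interval_def U_def)
  have sU: "(s, 0) \<in> U" using s \<delta> by (simp add: U_def)
  define S where "S = {t. (s, 0) + t *\<^sub>R (0, 1) \<in> U}"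
  define a where "a = (\<lambda>k t. (directional_deriv (0, 1) ^^ k) (directional_deriv (1, 0) f) ((s, 0) + t *\<^sub>R (0, 1)))"
  define b where "b = (\<lambda>k t. (directional_deriv (0, 1) ^^ k) (directional_deriv (0, 1) f) ((s, 0) + t *\<^sub>R (0, 1)))"
  have towers: "derivative_tower S a" "derivative_tower S b"
    unfolding S_def a_def b_def
    by (intro derivative_tower_along_line smooth_on_directional_deriv f)+
  have "S = {-\<delta><..<\<delta>}" using s by (auto simp: S_def U_def)
  then have S: "open S" "0 \<in> S" using \<delta> by auto
  have partials: "partial_s f (s, t) = a 0 t" "partial_t f (s, t) = b 0 t" if "t \<in> S" for t
    using that partials_eq_directional_deriv[OF f, of f s t] by (simp_all add: S_def a_def b_def)
  have "((\<lambda>y. f (y, 0)) has_vector_derivative a 0 0) (at s)"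
    using has_vector_derivative_along_line[OF f, of "(0, 0)" s "(1, 0)"] sU by (simp add: a_def)
  then have "(\<Gamma> has_vector_derivative a 0 0) (at s)"
    using I s \<Gamma> by (rule has_vector_derivative_transform_within_open)
  then have a0: "a 0 0 = velocity \<Gamma> s" by (simp add: velocity_def vector_derivative_at)
  have a1: "a 1 0 = 0" using mixed_partial_eq_0[OF edge s] by (simp add: a_def)
  have b0: "b 0 0 = 0" using ft0 partials(2)[OF S(2)] by simp
  have "partial_t f y = directional_deriv (0, 1) f y" if "y \<in> U" for y
    using partials_eq_directional_deriv(2)[OF f, of f "fst y" "snd y"] that by simp
  then have b1: "b 1 0 = partial_tt f (s, 0)"
    using partials_eq_directional_deriv(2)[OF smooth_on_directional_deriv[OF f], of "partial_t f" "(0, 1)" s 0] sU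
    by (simp add: b_def)
  have "\<forall>\<^sub>F t in nhds 0. Delta_L f (s, t)
      = lorentz (a 0 t) (a 0 t) * lorentz (b 0 t) (b 0 t) - (lorentz (a 0 t) (b 0 t))\<^sup>2"
    using eventually_nhds_in_open[OF S]
    by eventually_elim (simp add: Delta_L_def partials)
  then have D: "D k = (deriv ^^ k) (\<lambda>t. lorentz (a 0 t) (a 0 t) * lorentz (b 0 t) (b 0 t)
      - (lorentz (a 0 t) (b 0 t))\<^sup>2) 0" for k
    unfolding D_def by (intro higher_deriv_cong_ev refl)
  have c: "c = lorentz (a 0 0) (b 1 0)" by (simp only: c_def a0 b1)
  note gram = gram_tower_at_singular_point[OF towers S _ a1 b0]
  show "D 0 = 0" "D 1 = 0" "D 2 = - 2 * c\<^sup>2" "c = 0 \<Longrightarrow> D 3 = 0"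
    unfolding D c using gram null by (simp_all only: a0)
qed

lemma Delta_order_at_null_tangent:
  assumes edge: "generalized_cuspidal_edge I \<delta> \<Gamma> f" and s: "s \<in> I"
    and null: "lorentz (velocity \<Gamma> s) (velocity \<Gamma> s) = 0"
  defines "c \<equiv> lorentz (velocity \<Gamma> s) (partial_tt f (s, 0))"
  shows "c \<noteq> 0 \<Longrightarrow> Delta_order f s = 2" "c = 0 \<Longrightarrow> Delta_order f s \<ge> 4"
proof -
  define D where "D = (\<lambda>k. (deriv ^^ k) (\<lambda>t. Delta_L f (s, t)) 0)"
  have D: "D 0 = 0" "D 1 = 0" "D 2 = - 2 * c\<^sup>2" "c = 0 \<Longrightarrow> D 3 = 0"
    using Delta_L_derivatives_at_null_tangent[OF edge s null] by (simp_all add: c_def D_def)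
  have order: "Delta_order f s = (if \<exists>k. D k \<noteq> 0 then enat (LEAST k. D k \<noteq> 0) else \<infinity>)"
    by (simp add: Delta_order_def D_def Let_def)
  show "Delta_order f s = 2" if "c \<noteq> 0"
  proof -
    have D2: "D 2 \<noteq> 0" using D(3) that by simp
    have "(LEAST k. D k \<noteq> 0) = 2"
    proof (rule Least_equality)
      show "D 2 \<noteq> 0" by (fact D2)
      show "2 \<le> k" if "D k \<noteq> 0" for k
      proof (rule ccontr)
        assume "\<not> 2 \<le> k"
        then have "k = 0 \<or> k = 1" by auto
        then show False using that D(1,2) by auto
      qed
    qed
    moreover have "\<exists>k. D k \<noteq> 0" using D2 by blast
    ultimately show ?thesis by (simp add: order numeral_eq_enat)
  qed
  show "Delta_order f s \<ge> 4" if "c = 0"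
  proof (cases "\<exists>k. D k \<noteq> 0")
    case True
    then have "D (LEAST k. D k \<noteq> 0) \<noteq> 0" by (rule LeastI_ex)
    moreover have "D k = 0" if "k < 4" for k
    proof -
      have "k = 0 \<or> k = 1 \<or> k = 2 \<or> k = 3" using that by auto
      then show ?thesis using D \<open>c = 0\<close> by auto
    qed
    ultimately have "4 \<le> (LEAST k. D k \<noteq> 0)" by (meson not_le)
    with True show ?thesis by (simp add: order numeral_eq_enat)
  qed (simp add: order)
qed

section \<open>The normal direction\<close>

unbundle cross3_syntax

text \<open>The isometry that turns \<open>\<langle>a, b\<rangle>\<^sub>L\<close> into the Euclidean inner product of \<open>time_reflect a\<close> with \<open>b\<close>. It
  reduces Lorentz orthogonality to the Euclidean cross product.\<close>

definition time_reflect :: "real^3 \<Rightarrow> real^3" where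
  "time_reflect a = vector [a$1, a$2, - a$3]"

lemma time_reflect_simps [simp]:
  "time_reflect (time_reflect a) = a" "time_reflect (c *\<^sub>R a) = c *\<^sub>R time_reflect a"
  "time_reflect a = 0 \<longleftrightarrow> a = 0"
  by (simp_all add: time_reflect_def vec_eq_iff forall_3)

lemma inner_time_reflect: "time_reflect a \<bullet> b = lorentz a b" "a \<bullet> time_reflect b = lorentz a b"
  by (simp_all add: time_reflect_def lorentz_def inner_vec_def sum_3)

lemma orthogonal_to_both_parallel_cross:
  fixes a b z :: "real^3"
  assumes "z \<bullet> a = 0" "z \<bullet> b = 0"
  shows "z \<times> (a \<times> b) = 0"
  using assms by (simp add: Lagrange)

lemma cross_eq_0_imp_multiple:
  fixes a b :: "real^3"
  assumes "a \<times> b = 0" "b \<noteq> 0"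
  obtains k where "a = k *\<^sub>R b"
proof -
  have "b \<times> a = 0" using assms(1) by (metis cross_skew neg_equal_0_iff_equal)
  then have "b = 0 \<or> a = 0 \<or> (\<exists>k. a = k *\<^sub>R b)"
    by (simp only: cross_eq_0 collinear_lemma)
  with assms(2) have "\<exists>k. a = k *\<^sub>R b" by (auto intro: exI[of _ 0])
  then show thesis using that by blast
qed

text \<open>The Lorentzian cross product of \<open>a\<close> and \<open>b\<close>, up to sign.\<close>

definition normal_vector :: "real^3 \<Rightarrow> real^3 \<Rightarrow> real^3" where
  "normal_vector a b = time_reflect (a \<times> b)"

text \<open>After \<open>time_reflect\<close>, a vector of the normal direction is Euclidean-orthogonal to both factors of the cross
  product, hence parallel to it.\<close>

lemma normal_direction_eq_span:
  assumes "velocity \<Gamma> s \<times> partial_tt f (s, 0) \<noteq> 0"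
  shows "normal_direction \<Gamma> f s = span {normal_vector (velocity \<Gamma> s) (partial_tt f (s, 0))}"
proof -
  define a b where "a = velocity \<Gamma> s" and "b = partial_tt f (s, 0)"
  have "lorentz v a = 0 \<and> lorentz v b = 0 \<longleftrightarrow> v \<in> span {normal_vector a b}" for v
  proof
    assume "lorentz v a = 0 \<and> lorentz v b = 0"
    then have "time_reflect v \<times> (a \<times> b) = 0"
      by (intro orthogonal_to_both_parallel_cross) (simp_all add: inner_time_reflect)
    with assms obtain k where "time_reflect v = k *\<^sub>R (a \<times> b)"
      by (metis a_def b_def cross_eq_0_imp_multiple)
    then have "v = k *\<^sub>R normal_vector a b"
      by (metis normal_vector_def time_reflect_simps(1,2))
    then show "v \<in> span {normal_vector a b}" by (simp add: span_scale span_base)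
  next
    assume "v \<in> span {normal_vector a b}"
    then obtain k where "v = k *\<^sub>R normal_vector a b" by (auto simp: span_singleton)
    then show "lorentz v a = 0 \<and> lorentz v b = 0"
      by (simp add: normal_vector_def dot_cross_self flip: inner_time_reflect)
  qed
  then show ?thesis by (auto simp: normal_direction_def a_def b_def)
qed

text \<open>The Lorentzian counterpart of Lagrange's identity \<open>norm_cross_dot\<close>.\<close>

lemma lorentz_normal_vector:
  "lorentz (normal_vector a b) (normal_vector a b) = (lorentz a b)\<^sup>2 - lorentz a a * lorentz b b"
  unfolding normal_vector_def time_reflect_def lorentz_def cross3_def vector_3
  by algebra

text \<open>Rescaling a spanning vector by \<open>k \<noteq> 0\<close> multiplies its Lorentz square by \<open>k\<^sup>2 > 0\<close>.\<close>

lemma direction_of_span: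
  assumes "n \<noteq> 0"
  shows "space_like_direction (span {n}) \<longleftrightarrow> lorentz n n > 0"
    and "light_like_direction (span {n}) \<longleftrightarrow> lorentz n n = 0"
proof -
  have *: "\<exists>k. k \<noteq> 0 \<and> lorentz v v = k\<^sup>2 * lorentz n n" if "span {n} = span {v}" "v \<noteq> 0" for v
  proof -
    have "v \<in> span {n}" using that by (simp add: span_base)
    then obtain k where "v = k *\<^sub>R n" by (auto simp: span_singleton)
    with that(2) show ?thesis
      by (intro exI[of _ k]) (auto simp: lorentz_def power2_eq_square algebra_simps)
  qed
  show "space_like_direction (span {n}) \<longleftrightarrow> lorentz n n > 0"
    using * assms by (force simp: space_like_direction_def space_like_def zero_less_mult_iff)
  show "light_like_direction (span {n}) \<longleftrightarrow> lorentz n n = 0"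
    using * assms by (force simp: light_like_direction_def light_like_def)
qed

lemma cross_nonzero_of_independent:
  fixes a b :: "real^3"
  assumes "independent {b, a}" "b \<noteq> a"
  shows "a \<times> b \<noteq> 0"
proof
  assume "a \<times> b = 0"
  moreover have "b \<noteq> 0" using assms(1) dependent_zero by blast
  ultimately obtain k where "a = k *\<^sub>R b" by (rule cross_eq_0_imp_multiple)
  then have "a \<in> span ({a, b} - {a})" using assms(2)
    by (simp add: span_scale span_base insert_Diff_if)
  then have "dependent {b, a}" unfolding dependent_def by (auto simp: insert_commute)
  with assms(1) show False by simp
qed

section \<open>Curves with light-like tangent\<close>

text \<open>Both \<open>a\<close> and \<open>c\<close> are Euclidean-orthogonal to \<open>time_reflect a \<noteq> 0\<close>, so \<open>c \<times> a\<close> is a multiple \<open>k\<close> of it;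
  the determinant is the triple product of \<open>b\<close> with \<open>c \<times> a\<close>.\<close>

lemma det_null_tangent:
  assumes "light_like a" "lorentz a c = 0"
  obtains k where "\<And>b. det (vector [a, b, c] :: real^3^3) = k * lorentz a b"
    and "c \<notin> span {a} \<Longrightarrow> k \<noteq> 0"
proof -
  have "a \<noteq> 0" "lorentz a a = 0" using assms(1) by (auto simp: light_like_def)
  have "time_reflect a \<times> (c \<times> a) = 0"
    using assms \<open>lorentz a a = 0\<close>
    by (intro orthogonal_to_both_parallel_cross) (simp_all add: inner_time_reflect)
  then have "(c \<times> a) \<times> time_reflect a = 0" by (metis cross_skew neg_equal_0_iff_equal)
  then obtain k where k: "c \<times> a = k *\<^sub>R time_reflect a"
    using \<open>a \<noteq> 0\<close> by (auto elim: cross_eq_0_imp_multiple)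
  show thesis
  proof
    fix b
    have "det (vector [a, b, c] :: real^3^3) = b \<bullet> (c \<times> a)"
      by (simp add: det_3 cross3_def inner_vec_def sum_3 algebra_simps)
    also have "\<dots> = k * lorentz a b" by (simp add: k inner_time_reflect lorentz_commute)
    finally show "det (vector [a, b, c] :: real^3^3) = k * lorentz a b" .
  next
    assume "c \<notin> span {a}"
    then have "c \<times> a \<noteq> 0"
      using \<open>a \<noteq> 0\<close> by (metis cross_eq_0_imp_multiple insertI1 span_base span_scale)
    with k show "k \<noteq> 0" by auto
  qed
qed

text \<open>Differentiate the identity \<open>\<langle>\<Gamma>', \<Gamma>'\<rangle>\<^sub>L = 0\<close>.\<close>

lemma type_L_acceleration_orthogonal:
  assumes \<Gamma>: "smooth_on I \<Gamma>" and L: "type_L I \<Gamma>" and s: "s \<in> I"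
  shows "lorentz (velocity \<Gamma> s) (acceleration \<Gamma> s) = 0"
proof -
  have I: "open I" using \<Gamma> by (simp add: smooth_on_def)
  have vel: "velocity \<Gamma> t = directional_deriv 1 \<Gamma> t" if "t \<in> I" for t
    using has_vector_derivative_along_line[OF \<Gamma>, of 0 t 1] that
    by (simp add: velocity_def vector_derivative_at)
  have "(directional_deriv 1 \<Gamma> has_vector_derivative directional_deriv 1 (directional_deriv 1 \<Gamma>) s) (at s)"
    using has_vector_derivative_along_line[OF smooth_on_directional_deriv[OF \<Gamma>], of 0 s 1] s by simp
  then have "(velocity \<Gamma> has_vector_derivative directional_deriv 1 (directional_deriv 1 \<Gamma>) s) (at s)"
    by (rule has_vector_derivative_transform_within_open[OF _ I s]) (simp add: vel)
  then have acc: "(velocity \<Gamma> has_vector_derivative acceleration \<Gamma> s) (at s)"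
    by (simp add: acceleration_def vector_derivative_at)
  have "((\<lambda>t. lorentz (velocity \<Gamma> t) (velocity \<Gamma> t)) has_vector_derivative
      lorentz (velocity \<Gamma> s) (acceleration \<Gamma> s) + lorentz (acceleration \<Gamma> s) (velocity \<Gamma> s)) (at s)"
    by (rule bounded_bilinear.has_vector_derivative[OF bounded_bilinear_lorentz acc acc])
  moreover have "((\<lambda>t. lorentz (velocity \<Gamma> t) (velocity \<Gamma> t)) has_vector_derivative 0) (at s)"
    by (rule has_vector_derivative_transform_within_open[OF has_vector_derivative_const I s])
      (use L in \<open>simp add: type_L_def light_like_def\<close>)
  ultimately have "lorentz (velocity \<Gamma> s) (acceleration \<Gamma> s) + lorentz (acceleration \<Gamma> s) (velocity \<Gamma> s) = 0"
    by (rule vector_derivative_unique_at)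
  then show ?thesis by (simp add: lorentz_commute)
qed

section \<open>The equivalence\<close>

theorem propositionC:
  fixes I :: "real set" and \<delta> s\<^sub>0 :: real
    and \<Gamma> :: "real \<Rightarrow> real^3" and f :: "real \<times> real \<Rightarrow> real^3"
  assumes "regular_curve I \<Gamma>"
    and "s\<^sub>0 \<in> I" and "light_like (velocity \<Gamma> s\<^sub>0)"
    and "generalized_cuspidal_edge I \<delta> \<Gamma> f"
  shows
    "(space_like_direction (normal_direction \<Gamma> f s\<^sub>0) \<longleftrightarrow> Delta_order f s\<^sub>0 = 2) \<and>
     (light_like_direction (normal_direction \<Gamma> f s\<^sub>0) \<longleftrightarrow> Delta_order f s\<^sub>0 \<ge> 4) \<and>
     (Delta_order f s\<^sub>0 > 2 \<longrightarrow> Delta_order f s\<^sub>0 \<ge> 4) \<and>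
     (type_L I \<Gamma> \<and> acceleration \<Gamma> s\<^sub>0 \<noteq> 0 \<longrightarrow>
        (sigma_C \<Gamma> f s\<^sub>0 \<noteq> 0 \<longrightarrow>
           space_like_direction (normal_direction \<Gamma> f s\<^sub>0) \<and> Delta_order f s\<^sub>0 = 2) \<and>
        (light_like_direction (normal_direction \<Gamma> f s\<^sub>0) \<and> Delta_order f s\<^sub>0 \<ge> 4 \<longrightarrow>
           sigma_C \<Gamma> f s\<^sub>0 = 0) \<and>
        (nonzero_curvature_at \<Gamma> s\<^sub>0 \<longrightarrow>
           (space_like_direction (normal_direction \<Gamma> f s\<^sub>0) \<and> Delta_order f s\<^sub>0 = 2
              \<longleftrightarrow> sigma_C \<Gamma> f s\<^sub>0 \<noteq> 0) \<and>
           (light_like_direction (normal_direction \<Gamma> f s\<^sub>0) \<and> Delta_order f s\<^sub>0 \<ge> 4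
              \<longleftrightarrow> sigma_C \<Gamma> f s\<^sub>0 = 0)))"
proof -
  let ?\<xi> = "velocity \<Gamma> s\<^sub>0" and ?w = "partial_tt f (s\<^sub>0, 0)" and ?N = "normal_direction \<Gamma> f s\<^sub>0"
  define c where "c = lorentz ?\<xi> ?w"
  have null: "lorentz ?\<xi> ?\<xi> = 0" using assms(3) by (simp add: light_like_def)
  have order: "c \<noteq> 0 \<Longrightarrow> Delta_order f s\<^sub>0 = 2" "c = 0 \<Longrightarrow> Delta_order f s\<^sub>0 \<ge> 4"
    using Delta_order_at_null_tangent[OF assms(4,2) null] by (simp_all add: c_def)
  have not_both: "\<not> (4::enat) \<le> 2" by (simp add: numeral_eq_enat)
  have two_iff: "Delta_order f s\<^sub>0 = 2 \<longleftrightarrow> c \<noteq> 0" and four_iff: "Delta_order f s\<^sub>0 \<ge> 4 \<longleftrightarrow> c = 0"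
    using order not_both by (cases "c = 0"; fastforce)+
  have cross: "?\<xi> \<times> ?w \<noteq> 0"
    using assms(2,4) cross_nonzero_of_independent by (auto simp: generalized_cuspidal_edge_def)
  have N: "?N = span {normal_vector ?\<xi> ?w}" by (rule normal_direction_eq_span[OF cross])
  have n: "normal_vector ?\<xi> ?w \<noteq> 0" using cross by (simp add: normal_vector_def)
  have space_iff: "space_like_direction ?N \<longleftrightarrow> c \<noteq> 0" and light_iff: "light_like_direction ?N \<longleftrightarrow> c = 0"
    unfolding N direction_of_span[OF n] by (simp_all add: lorentz_normal_vector null c_def)
  have gap: "Delta_order f s\<^sub>0 \<ge> 4" if "Delta_order f s\<^sub>0 > 2"
    using that two_iff four_iff by auto
  have sigma: "(sigma_C \<Gamma> f s\<^sub>0 \<noteq> 0 \<longrightarrow> c \<noteq> 0)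
      \<and> (nonzero_curvature_at \<Gamma> s\<^sub>0 \<longrightarrow> (sigma_C \<Gamma> f s\<^sub>0 \<noteq> 0 \<longleftrightarrow> c \<noteq> 0))" if L: "type_L I \<Gamma>"
  proof -
    have "smooth_on I \<Gamma>" using assms(1) by (simp add: regular_curve_def)
    then have "lorentz ?\<xi> (acceleration \<Gamma> s\<^sub>0) = 0"
      by (rule type_L_acceleration_orthogonal[OF _ L assms(2)])
    then obtain k where
      k: "\<And>b. det (vector [?\<xi>, b, acceleration \<Gamma> s\<^sub>0] :: real^3^3) = k * lorentz ?\<xi> b"
        "acceleration \<Gamma> s\<^sub>0 \<notin> span {?\<xi>} \<Longrightarrow> k \<noteq> 0"
      using det_null_tangent[OF assms(3)] by metis
    then show ?thesis by (auto simp: sigma_C_def sgn_0_0 c_def nonzero_curvature_at_def)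
  qed
  show ?thesis
    unfolding space_iff light_iff two_iff four_iff using gap[unfolded four_iff] sigma by blast
qed

end
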